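(* There are reflexive Banach spaces $E_1$, $E_2$, and $E_3$, all of them isomorphic to $\ell_2$, such that the pairs $(\ell_2, E_1)$, $(E_2, \ell_2)$, and $(E_3,E_3)$ fail the WMP.
   Context: Banach spaces are over $\mathbb{K} = \mathbb{R}$ or $\mathbb{C}$; "isomorphic" means linearly homeomorphic. A bounded linear operator $T:E\to F$ attains its norm if there is $x_0$ in the unit sphere $S_E$ with $\|T(x_0)\|=\|T\|$. A maximizing sequence for $T$ is a sequence $(x_n)\subset S_E$ with $\|T(x_n)\|\to\|T\|$. A pair $(E,F)$ of Banach spaces has the weak maximizing property (WMP) if every bounded linear operator $T:E\to F$ that admits a non-weakly null maximizing sequence (i.e. one not converging weakly to $0$) attains its norm. *)

theory Defs
  imports "HOL-Analysis.Analysis" "HOL-Library.Function_Algebras"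
begin

text \<open>
  Banach spaces are rendered as explicit structures, because the theorem quantifies
  existentially over them. The scalar field is a type \<open>'k\<close> (instantiated by \<^typ>\<open>real\<close> and
  \<^typ>\<open>complex\<close> in the theorem); the underlying vector space is a linear subspace \<open>carr\<close> of an
  ambient vector space \<open>'a\<close> with scalar multiplication \<open>scal\<close>. The norm \<open>nrm\<close> and all operators
  are only relevant on the carrier. Addition on function types is pointwise.
\<close>

record ('k, 'a) normed_space =
  carr :: "'a set"
  scal :: "'k \<Rightarrow> 'a \<Rightarrow> 'a"
  nrm :: "'a \<Rightarrow> real"

definition is_normed_space ::
  "('k::real_normed_field, 'a::ab_group_add) normed_space \<Rightarrow> bool" where
  "is_normed_space E \<longleftrightarrow>
     vector_space (scal E) \<and> module.subspace (scal E) (carr E) \<and>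
     (\<forall>x\<in>carr E. 0 \<le> nrm E x \<and> (nrm E x = 0 \<longleftrightarrow> x = 0)) \<and>
     (\<forall>x\<in>carr E. \<forall>c. nrm E (scal E c x) = norm c * nrm E x) \<and>
     (\<forall>x\<in>carr E. \<forall>y\<in>carr E. nrm E (x + y) \<le> nrm E x + nrm E y)"

text \<open>
  The locale \<^locale>\<open>Metric_space\<close> demands nonnegativity and symmetry of the distance also off
  the carrier, hence the default value 0 there.
\<close>

definition nrm_dist :: "('k, 'a::ab_group_add) normed_space \<Rightarrow> 'a \<Rightarrow> 'a \<Rightarrow> real" where
  "nrm_dist E x y = (if x \<in> carr E \<and> y \<in> carr E then nrm E (x - y) else 0)"

lemma Metric_space_nrm_dist:
  assumes "is_normed_space E"
  shows "Metric_space (carr E) (nrm_dist E)"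
proof -
  have vs: "vector_space (scal E)" and sub: "module.subspace (scal E) (carr E)"
    and pos: "\<And>x. x \<in> carr E \<Longrightarrow> 0 \<le> nrm E x \<and> (nrm E x = 0 \<longleftrightarrow> x = 0)"
    and hom: "\<And>x c. x \<in> carr E \<Longrightarrow> nrm E (scal E c x) = norm c * nrm E x"
    and tri: "\<And>x y. x \<in> carr E \<Longrightarrow> y \<in> carr E \<Longrightarrow> nrm E (x + y) \<le> nrm E x + nrm E y"
    using assms by (auto simp: is_normed_space_def)
  interpret vector_space "scal E" by (rule vs)
  have diff: "x - y \<in> carr E" if "x \<in> carr E" "y \<in> carr E" for x y
    using subspace_diff[OF sub] that by blast
  have comm: "nrm E (x - y) = nrm E (y - x)" if "x \<in> carr E" "y \<in> carr E" for x y
    using hom[of "x - y" "-1"] diff[OF that] by simp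
  have tri': "nrm E (x - z) \<le> nrm E (x - y) + nrm E (y - z)"
    if "x \<in> carr E" "y \<in> carr E" "z \<in> carr E" for x y z
    using tri[of "x - y" "y - z"] diff that by simp
  show ?thesis
    by unfold_locales (use pos diff comm tri' in \<open>auto simp: nrm_dist_def\<close>)
qed

definition banach_space ::
  "('k::real_normed_field, 'a::ab_group_add) normed_space \<Rightarrow> bool" where
  "banach_space E \<longleftrightarrow> is_normed_space E \<and> Metric_space.mcomplete (carr E) (nrm_dist E)"

definition nrm_topology :: "('k, 'a::ab_group_add) normed_space \<Rightarrow> 'a topology" where
  "nrm_topology E = Metric_space.mtopology (carr E) (nrm_dist E)"

definition unit_sphere :: "('k, 'a) normed_space \<Rightarrow> 'a set" where
  "unit_sphere E = {x \<in> carr E. nrm E x = 1}"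

definition linear_map ::
  "('k, 'a::ab_group_add) normed_space \<Rightarrow> ('k, 'b::ab_group_add) normed_space \<Rightarrow> ('a \<Rightarrow> 'b) \<Rightarrow> bool"
  where
  "linear_map E F T \<longleftrightarrow>
     T ` carr E \<subseteq> carr F \<and>
     (\<forall>x\<in>carr E. \<forall>y\<in>carr E. T (x + y) = T x + T y) \<and>
     (\<forall>c. \<forall>x\<in>carr E. T (scal E c x) = scal F c (T x))"

definition bounded_linear_map ::
  "('k, 'a::ab_group_add) normed_space \<Rightarrow> ('k, 'b::ab_group_add) normed_space \<Rightarrow> ('a \<Rightarrow> 'b) \<Rightarrow> bool"
  where
  "bounded_linear_map E F T \<longleftrightarrow>
     linear_map E F T \<and> (\<exists>B. \<forall>x\<in>carr E. nrm F (T x) \<le> B * nrm E x)"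

definition op_norm ::
  "('k, 'a) normed_space \<Rightarrow> ('k, 'b) normed_space \<Rightarrow> ('a \<Rightarrow> 'b) \<Rightarrow> real" where
  "op_norm E F T = Sup {nrm F (T x) | x. x \<in> carr E \<and> nrm E x \<le> 1}"

definition isomorphic_spaces ::
  "('k, 'a::ab_group_add) normed_space \<Rightarrow> ('k, 'b::ab_group_add) normed_space \<Rightarrow> bool" where
  "isomorphic_spaces E F \<longleftrightarrow>
     (\<exists>T. linear_map E F T \<and> homeomorphic_map (nrm_topology E) (nrm_topology F) T)"

definition scalar_space :: "('k::real_normed_field, 'k) normed_space" where
  "scalar_space = \<lparr>carr = UNIV, scal = (*), nrm = norm\<rparr>"

text \<open>
  Since functionals are total functions on \<open>'a\<close>, those in the dual are required to vanish
  outside the carrier, so that each functional on the carrier has exactly one representative.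
\<close>

definition dual_space ::
  "('k::real_normed_field, 'a::ab_group_add) normed_space \<Rightarrow> ('k, 'a \<Rightarrow> 'k) normed_space" where
  "dual_space E =
     \<lparr>carr = {f. bounded_linear_map E scalar_space f \<and> (\<forall>x. x \<notin> carr E \<longrightarrow> f x = 0)},
      scal = (\<lambda>c f x. c * f x),
      nrm = op_norm E scalar_space\<rparr>"

text \<open>Reflexivity: the canonical embedding into the bidual is onto.\<close>

definition reflexive_space ::
  "('k::real_normed_field, 'a::ab_group_add) normed_space \<Rightarrow> bool" where
  "reflexive_space E \<longleftrightarrow>
     (\<forall>\<Phi>\<in>carr (dual_space (dual_space E)).
        \<exists>x\<in>carr E. \<forall>f\<in>carr (dual_space E). \<Phi> f = f x)"

definition weakly_null ::
  "('k::real_normed_field, 'a::ab_group_add) normed_space \<Rightarrow> (nat \<Rightarrow> 'a) \<Rightarrow> bool" where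
  "weakly_null E x \<longleftrightarrow> (\<forall>f\<in>carr (dual_space E). (\<lambda>n. f (x n)) \<longlonglongrightarrow> 0)"

definition attains_norm ::
  "('k, 'a) normed_space \<Rightarrow> ('k, 'b) normed_space \<Rightarrow> ('a \<Rightarrow> 'b) \<Rightarrow> bool" where
  "attains_norm E F T \<longleftrightarrow> (\<exists>x0\<in>unit_sphere E. nrm F (T x0) = op_norm E F T)"

definition maximizing_sequence ::
  "('k, 'a) normed_space \<Rightarrow> ('k, 'b) normed_space \<Rightarrow> ('a \<Rightarrow> 'b) \<Rightarrow> (nat \<Rightarrow> 'a) \<Rightarrow> bool" where
  "maximizing_sequence E F T x \<longleftrightarrow>
     (\<forall>n. x n \<in> unit_sphere E) \<and> (\<lambda>n. nrm F (T (x n))) \<longlonglongrightarrow> op_norm E F T"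

definition WMP ::
  "('k::real_normed_field, 'a::ab_group_add) normed_space \<Rightarrow>
   ('k, 'b::ab_group_add) normed_space \<Rightarrow> bool" where
  "WMP E F \<longleftrightarrow>
     (\<forall>T. bounded_linear_map E F T \<and>
          (\<exists>x. maximizing_sequence E F T x \<and> \<not> weakly_null E x) \<longrightarrow> attains_norm E F T)"

definition ell2 :: "('k::real_normed_field, nat \<Rightarrow> 'k) normed_space" where
  "ell2 = \<lparr>carr = {x. summable (\<lambda>n. (norm (x n))\<^sup>2)},
           scal = (\<lambda>c x n. c * x n),
           nrm = (\<lambda>x. sqrt (\<Sum>n. (norm (x n))\<^sup>2))\<rparr>"

end

theory Submission
  imports Defs
begin

text \<open>
  Let \<open>D\<close> be the diagonal operator with weights \<open>n / (n + 1)\<close>, which does not attain its norm 1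
  on \<open>\<ell>\<^sub>2\<close>, although \<open>D e\<^sub>n\<close> has norm tending to 1. The \<open>e\<^sub>n\<close> are weakly null, but on
  \<open>E\<^sub>2 = E\<^sub>3 = \<K> \<oplus>\<^sub>\<infinity> \<ell>\<^sub>2\<close> one can add a fixed vector for free: for \<open>T(a, x) = (0, D x)\<close> the sequence
  \<open>(1, e\<^sub>n)\<close> is maximizing, not weakly null, and the norm is not attained. For the first pair,
  take \<open>E\<^sub>1 = \<K> \<oplus>\<^sub>1 \<ell>\<^sub>2\<close> and \<open>T(a, x) = (a, D x)\<close> on \<open>\<K> \<oplus>\<^sub>2 \<ell>\<^sub>2\<close>: by AM-GM, \<open>T\<close> has norm \<open>\<surd>2\<close>, which
  is only approached, along \<open>(1, e\<^sub>n) / \<surd>2\<close>.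
\<close>

section \<open>The space of square summable sequences\<close>

lemma carr_ell2_iff: "x \<in> carr ell2 \<longleftrightarrow> summable (\<lambda>n. (norm (x n))\<^sup>2)"
  by (simp add: ell2_def)

lemma nrm_ell2: "nrm ell2 x = sqrt (\<Sum>n. (norm (x n))\<^sup>2)"
  by (simp add: ell2_def)

lemma scal_ell2: "scal ell2 = (\<lambda>c x n. c * x n)"
  by (simp add: ell2_def)

lemma nrm_ell2_power2:
  assumes "x \<in> carr ell2"
  shows "(nrm ell2 x)\<^sup>2 = (\<Sum>n. (norm (x n))\<^sup>2)"
  using assms by (simp add: carr_ell2_iff nrm_ell2 suminf_nonneg)

lemma nrm_ell2_nonneg: "x \<in> carr ell2 \<Longrightarrow> 0 \<le> nrm ell2 x"
  by (simp add: carr_ell2_iff nrm_ell2 suminf_nonneg)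

lemma L2_set_le_nrm_ell2:
  assumes "x \<in> carr ell2" "finite A"
  shows "L2_set (\<lambda>i. norm (x i)) A \<le> nrm ell2 x"
  unfolding L2_set_def nrm_ell2
  by (rule real_sqrt_le_mono, rule sum_le_suminf) (use assms in \<open>auto simp: carr_ell2_iff\<close>)

lemma norm_le_nrm_ell2: "x \<in> carr ell2 \<Longrightarrow> norm (x i) \<le> nrm ell2 x"
  using L2_set_le_nrm_ell2[of x "{i}"] by (simp add: L2_set_def)

text \<open>A uniform bound on finite sections passes to the series. Minkowski's inequality, the
  Riesz representation and completeness thus reduce to finite \<open>L2_set\<close>
  estimates.\<close>

lemma ell2_boundI:
  assumes "\<And>n. L2_set (\<lambda>i. norm (x i)) {..<n} \<le> B"
  shows "x \<in> carr ell2" "nrm ell2 x \<le> B"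
proof -
  have B: "0 \<le> B" using assms[of 0] by simp
  have le: "(\<Sum>i<n. (norm (x i))\<^sup>2) \<le> B\<^sup>2" for n
    using assms[of n] by (simp add: L2_set_def sqrt_le_D)
  have s: "summable (\<lambda>n. (norm (x n))\<^sup>2)"
    by (rule summableI_nonneg_bounded[where x = "B\<^sup>2"]) (use le in auto)
  then show "x \<in> carr ell2" by (simp add: carr_ell2_iff)
  have "(\<Sum>n. (norm (x n))\<^sup>2) \<le> B\<^sup>2" by (rule suminf_le_const[OF s le])
  then show "nrm ell2 x \<le> B" using B by (simp add: nrm_ell2 real_le_lsqrt)
qed

lemma ell2_add:
  fixes x y :: "nat \<Rightarrow> 'k::real_normed_field"
  assumes "x \<in> carr ell2" "y \<in> carr ell2"
  shows "x + y \<in> carr ell2" "nrm ell2 (x + y) \<le> nrm ell2 x + nrm ell2 y"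
proof -
  have "L2_set (\<lambda>i. norm ((x + y) i)) {..<n} \<le> nrm ell2 x + nrm ell2 y" for n
  proof -
    have "L2_set (\<lambda>i. norm ((x + y) i)) {..<n} \<le> L2_set (\<lambda>i. norm (x i) + norm (y i)) {..<n}"
      by (rule L2_set_mono) (auto simp: norm_triangle_ineq)
    also have "\<dots> \<le> L2_set (\<lambda>i. norm (x i)) {..<n} + L2_set (\<lambda>i. norm (y i)) {..<n}"
      by (rule L2_set_triangle_ineq)
    also have "\<dots> \<le> nrm ell2 x + nrm ell2 y"
      using assms by (intro add_mono L2_set_le_nrm_ell2) auto
    finally show ?thesis .
  qed
  then show "x + y \<in> carr ell2" "nrm ell2 (x + y) \<le> nrm ell2 x + nrm ell2 y"
    by (blast intro: ell2_boundI)+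
qed

lemma ell2_scale:
  fixes x :: "nat \<Rightarrow> 'k::real_normed_field"
  assumes "x \<in> carr ell2"
  shows "(\<lambda>n. c * x n) \<in> carr ell2" "nrm ell2 (\<lambda>n. c * x n) = norm c * nrm ell2 x"
proof -
  have s: "summable (\<lambda>n. (norm (x n))\<^sup>2)" using assms by (simp add: carr_ell2_iff)
  show "(\<lambda>n. c * x n) \<in> carr ell2"
    using summable_mult[OF s, of "(norm c)\<^sup>2"] by (simp add: carr_ell2_iff norm_mult power_mult_distrib)
  show "nrm ell2 (\<lambda>n. c * x n) = norm c * nrm ell2 x"
    by (simp add: nrm_ell2 norm_mult power_mult_distrib suminf_mult[OF s] real_sqrt_mult)
qed

lemma ell2_diff:
  fixes x y :: "nat \<Rightarrow> 'k::real_normed_field"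
  assumes "x \<in> carr ell2" "y \<in> carr ell2"
  shows "x - y \<in> carr ell2"
proof -
  have "x - y = x + (\<lambda>n. - 1 * y n)" by (auto simp: fun_eq_iff)
  then show ?thesis using ell2_add(1)[OF assms(1) ell2_scale(1)[OF assms(2)]] by metis
qed

lemma ell2_single:
  fixes c :: "'k::real_normed_field"
  shows "(\<lambda>_. 0)(n := c) \<in> carr ell2" "nrm ell2 ((\<lambda>_. 0)(n := c)) = norm c"
proof -
  have eq: "(norm (((\<lambda>_. 0)(n := c)) i))\<^sup>2 = (if i = n then (norm c)\<^sup>2 else 0)" for i
    by simp
  have "(\<lambda>i. (norm (((\<lambda>_. 0)(n := c)) i))\<^sup>2) sums (norm c)\<^sup>2"
    unfolding eq by (rule sums_single)
  then show "(\<lambda>_. 0)(n := c) \<in> carr ell2" "nrm ell2 ((\<lambda>_. 0)(n := c)) = norm c"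
    by (simp_all add: carr_ell2_iff nrm_ell2 sums_iff del: fun_upd_apply)
qed

lemma zero_in_ell2: "(0 :: nat \<Rightarrow> 'k::real_normed_field) \<in> carr ell2"
  by (simp add: carr_ell2_iff)

lemma nrm_ell2_zero: "nrm ell2 (0 :: nat \<Rightarrow> 'k::real_normed_field) = 0"
  by (simp add: nrm_ell2)

lemma nrm_ell2_eq_0D:
  assumes "x \<in> carr ell2" "nrm ell2 x = 0"
  shows "x = 0"
  using norm_le_nrm_ell2[OF assms(1)] assms(2) by (auto simp: fun_eq_iff)

lemma vector_space_ell2: "vector_space (scal (ell2 :: ('k::real_normed_field, nat \<Rightarrow> 'k) normed_space))"
  by unfold_locales (auto simp: scal_ell2 fun_eq_iff algebra_simps)

lemma subspace_ell2:
  "module.subspace (scal ell2) (carr (ell2 :: ('k::real_normed_field, nat \<Rightarrow> 'k) normed_space))"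
proof -
  interpret vector_space "scal (ell2 :: ('k, nat \<Rightarrow> 'k) normed_space)"
    by (rule vector_space_ell2)
  show ?thesis
    by (rule subspaceI) (use zero_in_ell2 ell2_add ell2_scale in \<open>auto simp: scal_ell2\<close>)
qed

lemma ell2_finite_support:
  fixes x :: "nat \<Rightarrow> 'k::real_normed_field"
  assumes "\<And>i. n \<le> i \<Longrightarrow> x i = 0"
  shows "x \<in> carr ell2" "nrm ell2 x = L2_set (\<lambda>i. norm (x i)) {..<n}"
proof -
  have "(\<lambda>i. (norm (x i))\<^sup>2) sums (\<Sum>i<n. (norm (x i))\<^sup>2)"
    by (rule sums_finite) (use assms in auto)
  then show "x \<in> carr ell2" "nrm ell2 x = L2_set (\<lambda>i. norm (x i)) {..<n}"
    by (simp_all add: carr_ell2_iff nrm_ell2 L2_set_def sums_iff)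
qed

section \<open>Duality\<close>

text \<open>Cauchy-Schwarz on finite sections, then the limit. The pairing is bilinear rather than
  sesquilinear, so it makes sense in a scalar field without conjugation.\<close>

lemma ell2_pairing:
  fixes a x :: "nat \<Rightarrow> 'k::{real_normed_field,banach}"
  assumes "a \<in> carr ell2" "x \<in> carr ell2"
  shows "summable (\<lambda>n. a n * x n)" "norm (\<Sum>n. a n * x n) \<le> nrm ell2 a * nrm ell2 x"
proof -
  have le: "(\<Sum>i<n. norm (a i * x i)) \<le> nrm ell2 a * nrm ell2 x" for n
  proof -
    have "(\<Sum>i<n. norm (a i * x i)) \<le> L2_set (\<lambda>i. norm (a i)) {..<n} * L2_set (\<lambda>i. norm (x i)) {..<n}"
      using L2_set_mult_ineq[of "\<lambda>i. norm (a i)" "\<lambda>i. norm (x i)" "{..<n}"] by (simp add: norm_mult)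
    also have "\<dots> \<le> nrm ell2 a * nrm ell2 x"
      using assms by (intro mult_mono L2_set_le_nrm_ell2 L2_set_nonneg nrm_ell2_nonneg) auto
    finally show ?thesis .
  qed
  have s: "summable (\<lambda>n. norm (a n * x n))"
    by (rule summableI_nonneg_bounded[OF _ le]) auto
  show "summable (\<lambda>n. a n * x n)" by (rule summable_norm_cancel[OF s])
  show "norm (\<Sum>n. a n * x n) \<le> nrm ell2 a * nrm ell2 x"
    using summable_norm[OF s] suminf_le_const[OF s le] by linarith
qed

lemma bounded_linear_map_ell2I:
  fixes f :: "(nat \<Rightarrow> 'k::real_normed_field) \<Rightarrow> 'k"
  assumes "\<And>x y. x \<in> carr ell2 \<Longrightarrow> y \<in> carr ell2 \<Longrightarrow> f (x + y) = f x + f y"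
    and "\<And>c x. x \<in> carr ell2 \<Longrightarrow> f (\<lambda>n. c * x n) = c * f x"
    and "\<And>x. x \<in> carr ell2 \<Longrightarrow> norm (f x) \<le> B * nrm ell2 x"
  shows "bounded_linear_map ell2 scalar_space f"
  using assms unfolding bounded_linear_map_def linear_map_def scalar_space_def scal_ell2
  by (auto intro: exI[of _ B])

text \<open>The coefficients are the values of \<open>g\<close> at the unit vectors. Testing
  \<open>g\<close> on truncated conjugates puts them in \<open>ell2\<close>; truncations of
  \<open>x\<close> converge to \<open>x\<close> in norm, so boundedness extends the formula from
  finite support to all of \<open>ell2\<close>.\<close>

lemma ell2_riesz:
  fixes g :: "(nat \<Rightarrow> 'k::{real_normed_field,banach}) \<Rightarrow> 'k"
  assumes "bounded_linear_map ell2 scalar_space g"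
  obtains a where "a \<in> carr ell2" "\<And>x. x \<in> carr ell2 \<Longrightarrow> g x = (\<Sum>n. a n * x n)"
proof -
  have add: "\<And>x y. x \<in> carr ell2 \<Longrightarrow> y \<in> carr ell2 \<Longrightarrow> g (x + y) = g x + g y"
    and scale: "\<And>c x. x \<in> carr ell2 \<Longrightarrow> g (\<lambda>n. c * x n) = c * g x"
    using assms by (auto simp: bounded_linear_map_def linear_map_def scalar_space_def scal_ell2)
  have "\<exists>B. \<forall>x\<in>carr ell2. norm (g x) \<le> B * nrm ell2 x"
    using assms by (simp add: bounded_linear_map_def scalar_space_def)
  then obtain B where B: "\<And>x. x \<in> carr ell2 \<Longrightarrow> norm (g x) \<le> B * nrm ell2 x" by blast
  define a where "a n = g ((\<lambda>_. 0)(n := 1))" for n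
  define trunc :: "nat \<Rightarrow> (nat \<Rightarrow> 'k) \<Rightarrow> nat \<Rightarrow> 'k"
    where "trunc n x = (\<lambda>i. if i < n then x i else 0)" for n x
  have trunc_in: "trunc n x \<in> carr ell2" for n x
    by (rule ell2_finite_support[of n]) (simp add: trunc_def)
  have g0: "g (\<lambda>_. 0) = 0" using scale[OF zero_in_ell2, of 0] by simp
  have g_trunc: "g (trunc n x) = (\<Sum>i<n. a i * x i)" for n x
  proof (induction n)
    case 0
    then show ?case by (simp add: trunc_def g0)
  next
    case (Suc n)
    have eq: "trunc (Suc n) x = trunc n x + (\<lambda>i. x n * ((\<lambda>_. 0)(n := 1)) i)"
      by (auto simp: trunc_def fun_eq_iff less_Suc_eq)
    show ?case unfolding eq
      by (subst add) (simp_all add: Suc trunc_in ell2_single ell2_scale scale a_def mult.commute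
          del: fun_upd_apply)
  qed
  have "L2_set (\<lambda>i. norm (a i)) {..<n} \<le> B" for n
  proof -
    \<comment> \<open>\<open>y i\<close> is the complex conjugate of \<open>a i\<close>, and 0 (by \<open>z / 0 = 0\<close>) where \<open>a i = 0\<close>.\<close>
    define y where "y i = of_real ((norm (a i))\<^sup>2) / a i" for i
    let ?L = "L2_set (\<lambda>i. norm (a i)) {..<n}"
    have ny: "norm (y i) = norm (a i)" for i
      by (cases "a i = 0") (simp_all add: y_def norm_divide norm_mult power2_eq_square)
    have ay: "a i * y i = of_real ((norm (a i))\<^sup>2)" for i
      by (cases "a i = 0") (simp_all add: y_def)
    have "L2_set (\<lambda>i. norm (trunc n y i)) {..<n} = ?L"
      by (rule L2_set_cong) (auto simp: trunc_def ny)
    then have nrm: "nrm ell2 (trunc n y) = ?L"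
      using ell2_finite_support(2)[of n "trunc n y"] by (simp add: trunc_def)
    have "g (trunc n y) = of_real (\<Sum>i<n. (norm (a i))\<^sup>2)"
      by (simp add: g_trunc ay)
    also have "(\<Sum>i<n. (norm (a i))\<^sup>2) = ?L\<^sup>2"
      by (simp add: L2_set_def sum_nonneg)
    \<comment> \<open>The vector \<open>trunc n y\<close> has norm \<open>?L\<close> and
      \<open>g\<close> takes the value \<open>?L\<^sup>2\<close> there, so one factor
      \<open>?L\<close> cancels. The case \<open>?L = 0\<close> uses \<open>0 \<le> B\<close>, read
      off at a unit vector.\<close>
    finally have "?L * ?L \<le> B * ?L"
      using B[OF trunc_in, of n y] nrm by (simp add: power2_eq_square norm_mult)
    moreover have "0 \<le> B"
      using B[OF ell2_single(1)[of 0 1]] norm_ge_zero[of "g ((\<lambda>_. 0)(0 := 1))"]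
      unfolding ell2_single by (simp del: norm_ge_zero)
    ultimately show ?thesis
      using L2_set_nonneg[of "\<lambda>i. norm (a i)" "{..<n}"] by (cases "?L = 0") auto
  qed
  then have a: "a \<in> carr ell2" by (rule ell2_boundI)
  moreover have "g x = (\<Sum>n. a n * x n)" if x: "x \<in> carr ell2" for x
  proof -
    have s: "summable (\<lambda>n. (norm (x n))\<^sup>2)" using x by (simp add: carr_ell2_iff)
    have rest: "x - trunc n x \<in> carr ell2" for n by (rule ell2_diff[OF x trunc_in])
    have bound: "norm (g (trunc n x) - g x) \<le> B * nrm ell2 (x - trunc n x)" for n
    proof -
      have "g (trunc n x + (x - trunc n x)) = g (trunc n x) + g (x - trunc n x)"
        by (rule add[OF trunc_in rest])
      then show ?thesis using B[OF rest[of n]] by (simp add: norm_minus_commute)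
    qed
    \<comment> \<open>The squared norm of the remainder is the tail of a convergent series, hence
      tends to 0.\<close>
    have nrm_rest: "nrm ell2 (x - trunc n x) = sqrt ((\<Sum>i. (norm (x i))\<^sup>2) - (\<Sum>i<n. (norm (x i))\<^sup>2))" for n
    proof -
      have "(norm ((x - trunc n x) i))\<^sup>2
          = (norm (x i))\<^sup>2 - (if i \<in> {..<n} then (norm (x i))\<^sup>2 else 0)" for i
        by (simp add: trunc_def)
      then have "(\<lambda>i. (norm ((x - trunc n x) i))\<^sup>2)
          sums ((\<Sum>i. (norm (x i))\<^sup>2) - (\<Sum>i<n. (norm (x i))\<^sup>2))"
        using sums_diff[OF summable_sums[OF s] sums_If_finite_set[of "{..<n}"]] by simp
      then show ?thesis by (simp add: nrm_ell2 sums_iff)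
    qed
    have "(\<lambda>n. B * nrm ell2 (x - trunc n x))
        \<longlonglongrightarrow> B * sqrt ((\<Sum>i. (norm (x i))\<^sup>2) - (\<Sum>i. (norm (x i))\<^sup>2))"
      unfolding nrm_rest by (intro tendsto_intros summable_LIMSEQ[OF s])
    then have "(\<lambda>n. B * nrm ell2 (x - trunc n x)) \<longlonglongrightarrow> 0"
      by (simp only: diff_self real_sqrt_zero mult_zero_right)
    then have "(\<lambda>n. g (trunc n x) - g x) \<longlonglongrightarrow> 0"
      by (rule Lim_null_comparison[OF always_eventually[OF allI[OF bound]]])
    then have "(\<lambda>n. \<Sum>i<n. a i * x i) \<longlonglongrightarrow> g x"
      by (simp add: LIM_zero_iff g_trunc)
    moreover have "(\<lambda>n. \<Sum>i<n. a i * x i) \<longlonglongrightarrow> (\<Sum>n. a n * x n)"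
      by (rule summable_LIMSEQ[OF ell2_pairing(1)[OF a x]])
    ultimately show ?thesis by (rule LIMSEQ_unique)
  qed
  ultimately show ?thesis using that by blast
qed

section \<open>Equivalent norms\<close>

lemma scal_dual: "scal (dual_space E) = (\<lambda>c f x. c * f x)"
  by (simp add: dual_space_def)

lemma nrm_dual: "nrm (dual_space E) = op_norm E scalar_space"
  by (simp add: dual_space_def)

text \<open>The point \<open>z\<close> witnesses that the supremum defining \<open>op_norm\<close>
  ranges over a nonempty set.\<close>

lemma op_norm_le:
  assumes "z \<in> carr E" "nrm E z \<le> 1" "0 \<le> B" "\<And>x. x \<in> carr E \<Longrightarrow> nrm F (T x) \<le> B * nrm E x"
  shows "op_norm E F T \<le> B"
  unfolding op_norm_def
proof (rule cSup_least)
  show "{nrm F (T x) |x. x \<in> carr E \<and> nrm E x \<le> 1} \<noteq> {}" using assms(1,2) by blast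
  fix r assume "r \<in> {nrm F (T x) |x. x \<in> carr E \<and> nrm E x \<le> 1}"
  then obtain x where "r = nrm F (T x)" "x \<in> carr E" "nrm E x \<le> 1" by blast
  then show "r \<le> B" using assms(4)[of x] mult_left_mono[OF _ assms(3), of "nrm E x" 1] by linarith
qed

text \<open>An equivalent norm on \<open>ell2\<close>, with one constant for both directions;
  nonnegativity and definiteness follow from the comparison. Completeness, reflexivity and the
  isomorphism are proved here once for all the spaces constructed later.\<close>

locale ell2_renorming =
  fixes N :: "(nat \<Rightarrow> 'k::{real_normed_field,banach}) \<Rightarrow> real" and C :: real
  assumes C_pos: "0 < C"
    and nrm_le: "x \<in> carr ell2 \<Longrightarrow> nrm ell2 x \<le> C * N x"
    and le_nrm: "x \<in> carr ell2 \<Longrightarrow> N x \<le> C * nrm ell2 x"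
    and N_add: "x \<in> carr ell2 \<Longrightarrow> y \<in> carr ell2 \<Longrightarrow> N (x + y) \<le> N x + N y"
    and N_scale: "x \<in> carr ell2 \<Longrightarrow> N (\<lambda>n. c * x n) = norm c * N x"
begin

definition E :: "('k, nat \<Rightarrow> 'k) normed_space" where "E = ell2\<lparr>nrm := N\<rparr>"

lemma E_simps [simp]: "carr E = carr ell2" "scal E = scal ell2" "nrm E = N"
  by (simp_all add: E_def)

lemma N_nonneg: "x \<in> carr ell2 \<Longrightarrow> 0 \<le> N x"
  using nrm_le[of x] nrm_ell2_nonneg[of x] C_pos by (meson order_trans zero_le_mult_iff not_le)

lemma N_eq_0_iff: "x \<in> carr ell2 \<Longrightarrow> N x = 0 \<longleftrightarrow> x = 0"
  using nrm_le[of x] nrm_ell2_nonneg[of x] nrm_ell2_eq_0D[of x] le_nrm[of x] N_nonneg[of x]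
  by (auto simp: nrm_ell2_zero)

lemma is_normed_space_E: "is_normed_space E"
  unfolding is_normed_space_def
  using vector_space_ell2 subspace_ell2 N_nonneg N_eq_0_iff N_scale N_add
  by (simp add: scal_ell2)

sublocale Metric_space "carr ell2" "nrm_dist E"
  using Metric_space_nrm_dist[OF is_normed_space_E] by simp

lemma nrm_dist_E: "x \<in> carr ell2 \<Longrightarrow> y \<in> carr ell2 \<Longrightarrow> nrm_dist E x y = N (x - y)"
  by (simp add: nrm_dist_def)

text \<open>An \<open>N\<close>-Cauchy sequence is Cauchy for the \<open>ell2\<close> norm, hence in
  each coordinate. The coordinatewise limit \<open>y\<close> is then shown to lie in
  \<open>ell2\<close> and to be the limit in norm.\<close>

lemma banach_space_E: "banach_space E"
proof -
  have "\<exists>x. limitin mtopology \<sigma> x sequentially" if \<sigma>: "MCauchy \<sigma>" for \<sigma>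
  proof -
    have in_ell2: "\<sigma> n \<in> carr ell2" for n
      using \<sigma> by (auto simp: MCauchy_def)
    have cauchy: "\<exists>M. \<forall>m\<ge>M. \<forall>n\<ge>M. nrm ell2 (\<sigma> m - \<sigma> n) \<le> e" if "0 < e" for e
    proof -
      have "0 < e / C" using that C_pos by simp
      then obtain M where M: "\<And>m n. M \<le> m \<Longrightarrow> M \<le> n \<Longrightarrow> N (\<sigma> m - \<sigma> n) < e / C"
        using \<sigma> nrm_dist_E[OF in_ell2 in_ell2] unfolding MCauchy_def by metis
      have "nrm ell2 (\<sigma> m - \<sigma> n) \<le> e" if "M \<le> m" "M \<le> n" for m n
        using M[OF that] nrm_le[OF ell2_diff[OF in_ell2 in_ell2], of m n] C_pos
        by (simp add: field_simps)
      then show ?thesis by blast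
    qed
    have "Cauchy (\<lambda>m. \<sigma> m i)" for i
    proof (rule metric_CauchyI)
      fix e :: real assume "0 < e"
      then obtain M where M: "\<And>m n. M \<le> m \<Longrightarrow> M \<le> n \<Longrightarrow> nrm ell2 (\<sigma> m - \<sigma> n) \<le> e / 2"
        using cauchy[of "e / 2"] by auto
      have "dist (\<sigma> m i) (\<sigma> n i) < e" if "M \<le> m" "M \<le> n" for m n
        using M[OF that] norm_le_nrm_ell2[OF ell2_diff[OF in_ell2 in_ell2], of m n i] \<open>0 < e\<close>
        by (simp add: dist_norm)
      then show "\<exists>M. \<forall>m\<ge>M. \<forall>n\<ge>M. dist (\<sigma> m i) (\<sigma> n i) < e" by blast
    qed
    then have "\<exists>y. (\<lambda>m. \<sigma> m i) \<longlonglongrightarrow> y" for i by (simp add: Cauchy_convergent_iff convergent_def)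
    then obtain y where y: "\<And>i. (\<lambda>m. \<sigma> m i) \<longlonglongrightarrow> y i" by metis
    \<comment> \<open>The Cauchy estimate is passed to the limit in \<open>n\<close> on a finite
      section, where the norm is continuous in the coordinates.\<close>
    have L2: "L2_set (\<lambda>i. norm ((\<sigma> m - y) i)) {..<k} \<le> e"
      if M: "\<forall>m\<ge>M. \<forall>n\<ge>M. nrm ell2 (\<sigma> m - \<sigma> n) \<le> e" and "M \<le> m" for M m k e
    proof (rule LIMSEQ_le_const2)
      show "(\<lambda>n. L2_set (\<lambda>i. norm ((\<sigma> m - \<sigma> n) i)) {..<k})
          \<longlonglongrightarrow> L2_set (\<lambda>i. norm ((\<sigma> m - y) i)) {..<k}"
        unfolding L2_set_def fun_diff_def by (intro tendsto_intros y)
      show "\<exists>K. \<forall>n\<ge>K. L2_set (\<lambda>i. norm ((\<sigma> m - \<sigma> n) i)) {..<k} \<le> e"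
        using M \<open>M \<le> m\<close> L2_set_le_nrm_ell2[OF ell2_diff[OF in_ell2 in_ell2], of "{..<k}" m]
        by (meson finite_lessThan order_trans)
    qed
    have y_in: "y \<in> carr ell2"
    proof -
      obtain M where M: "\<forall>m\<ge>M. \<forall>n\<ge>M. nrm ell2 (\<sigma> m - \<sigma> n) \<le> 1"
        using cauchy[of 1] by auto
      have "\<sigma> M - y \<in> carr ell2" by (rule ell2_boundI[OF L2[OF M order_refl]])
      \<comment> \<open>Here \<open>y\<close> is recovered as
        \<open>\<sigma> M - (\<sigma> M - y)\<close>.\<close>
      then show ?thesis using ell2_diff[OF in_ell2[of M]] by force
    qed
    have "\<exists>M. \<forall>m\<ge>M. nrm_dist E (\<sigma> m) y < e" if "0 < e" for e
    proof -
      \<comment> \<open>The factor 2 turns the weak inequality of the limit estimate into a strict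
        one.\<close>
      have "0 < e / (2 * C)" using that C_pos by simp
      then obtain M where M: "\<forall>m\<ge>M. \<forall>n\<ge>M. nrm ell2 (\<sigma> m - \<sigma> n) \<le> e / (2 * C)"
        using cauchy by blast
      have "nrm_dist E (\<sigma> m) y < e" if "M \<le> m" for m
      proof -
        have "nrm ell2 (\<sigma> m - y) \<le> e / (2 * C)" by (rule ell2_boundI[OF L2[OF M that]])
        then have "C * nrm ell2 (\<sigma> m - y) \<le> e / 2" using C_pos by (simp add: field_simps)
        then show ?thesis
          using le_nrm[OF ell2_diff[OF in_ell2 y_in], of m] \<open>0 < e\<close> nrm_dist_E[OF in_ell2 y_in, of m]
          by linarith
      qed
      then show ?thesis by blast
    qed
    then show ?thesis using y_in in_ell2 by (auto simp: limit_metric_sequentially)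
  qed
  then show ?thesis
    unfolding banach_space_def using is_normed_space_E by (simp add: mcomplete_def)
qed

lemma bounded_linear_map_E_iff:
  "bounded_linear_map E scalar_space f \<longleftrightarrow> bounded_linear_map ell2 scalar_space f"
proof -
  have lin: "linear_map E scalar_space f \<longleftrightarrow> linear_map ell2 scalar_space f"
    by (simp add: linear_map_def)
  have "(\<exists>B. \<forall>x\<in>carr ell2. norm (f x) \<le> B * N x) \<longleftrightarrow>
        (\<exists>B. \<forall>x\<in>carr ell2. norm (f x) \<le> B * nrm ell2 x)"
  proof
    assume "\<exists>B. \<forall>x\<in>carr ell2. norm (f x) \<le> B * N x"
    then obtain B where B: "\<forall>x\<in>carr ell2. norm (f x) \<le> B * N x" ..
    \<comment> \<open>The sign of \<open>B\<close> is not given, so its absolute value is used for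
      monotonicity.\<close>
    have "norm (f x) \<le> (\<bar>B\<bar> * C) * nrm ell2 x" if "x \<in> carr ell2" for x
    proof -
      have "norm (f x) \<le> \<bar>B\<bar> * N x"
        using B that mult_right_mono[OF abs_ge_self N_nonneg[OF that], of B] by force
      also have "\<dots> \<le> \<bar>B\<bar> * (C * nrm ell2 x)" by (intro mult_left_mono le_nrm that) simp
      finally show ?thesis by (simp add: mult.assoc)
    qed
    then show "\<exists>B. \<forall>x\<in>carr ell2. norm (f x) \<le> B * nrm ell2 x" by blast
  next
    assume "\<exists>B. \<forall>x\<in>carr ell2. norm (f x) \<le> B * nrm ell2 x"
    then obtain B where B: "\<forall>x\<in>carr ell2. norm (f x) \<le> B * nrm ell2 x" ..
    have "norm (f x) \<le> (\<bar>B\<bar> * C) * N x" if "x \<in> carr ell2" for x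
    proof -
      have "norm (f x) \<le> \<bar>B\<bar> * nrm ell2 x"
        using B that mult_right_mono[OF abs_ge_self nrm_ell2_nonneg[OF that], of B] by force
      also have "\<dots> \<le> \<bar>B\<bar> * (C * N x)" by (intro mult_left_mono nrm_le that) simp
      finally show ?thesis by (simp add: mult.assoc)
    qed
    then show "\<exists>B. \<forall>x\<in>carr ell2. norm (f x) \<le> B * N x" by blast
  qed
  then show ?thesis using lin by (simp add: bounded_linear_map_def scalar_space_def)
qed

lemma carr_dual_E:
  "f \<in> carr (dual_space E) \<longleftrightarrow>
     bounded_linear_map ell2 scalar_space f \<and> (\<forall>x. x \<notin> carr ell2 \<longrightarrow> f x = 0)"
  by (simp add: dual_space_def bounded_linear_map_E_iff)

text \<open>The value 0 off the carrier matches the normalization in \<open>dual_space\<close>, so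
  that functionals can equal \<open>pairing a\<close> as total functions.\<close>

definition pairing :: "(nat \<Rightarrow> 'k) \<Rightarrow> (nat \<Rightarrow> 'k) \<Rightarrow> 'k" where
  "pairing a x = (if x \<in> carr ell2 then (\<Sum>n. a n * x n) else 0)"

lemma pairing_in_dual:
  assumes a: "a \<in> carr ell2"
  shows "pairing a \<in> carr (dual_space E)"
proof -
  have "pairing a (x + y) = pairing a x + pairing a y" if "x \<in> carr ell2" "y \<in> carr ell2" for x y
    using that suminf_add[OF ell2_pairing(1)[OF a that(1)] ell2_pairing(1)[OF a that(2)]]
    by (simp add: pairing_def ell2_add distrib_left)
  moreover have "pairing a (\<lambda>n. c * x n) = c * pairing a x" if "x \<in> carr ell2" for c x
    using that suminf_mult[OF ell2_pairing(1)[OF a that], of c]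
    by (simp add: pairing_def ell2_scale mult.left_commute)
  moreover have "norm (pairing a x) \<le> nrm ell2 a * nrm ell2 x" if "x \<in> carr ell2" for x
    using ell2_pairing(2)[OF a that] that by (simp add: pairing_def)
  ultimately have "bounded_linear_map ell2 scalar_space (pairing a)"
    by (rule bounded_linear_map_ell2I)
  then show ?thesis by (simp add: carr_dual_E pairing_def)
qed

text \<open>Makes \<open>a \<mapsto> pairing a\<close> bounded from \<open>ell2\<close> into the
  dual, so that a bidual element composed with it is a bounded functional on
  \<open>ell2\<close>.\<close>

lemma op_norm_pairing_le:
  assumes a: "a \<in> carr ell2"
  shows "op_norm E scalar_space (pairing a) \<le> C * nrm ell2 a"
proof (rule op_norm_le[of 0])
  show "0 \<in> carr E" "nrm E 0 \<le> 1" "0 \<le> C * nrm ell2 a"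
    using zero_in_ell2 N_eq_0_iff[OF zero_in_ell2] C_pos nrm_ell2_nonneg[OF a] by simp_all
  fix x assume "x \<in> carr E"
  then have x: "x \<in> carr ell2" by simp
  have "norm (pairing a x) \<le> nrm ell2 a * nrm ell2 x"
    using ell2_pairing(2)[OF a x] x by (simp add: pairing_def)
  also have "\<dots> \<le> nrm ell2 a * (C * N x)"
    by (intro mult_left_mono nrm_le x nrm_ell2_nonneg a)
  finally show "nrm scalar_space (pairing a x) \<le> C * nrm ell2 a * nrm E x"
    by (simp add: scalar_space_def mult_ac)
qed

text \<open>Riesz is applied twice: \<open>\<Phi>\<close> composed with \<open>pairing\<close> is
  represented by some \<open>b\<close>, and each \<open>f\<close> by some \<open>a\<close>. Symmetry
  of the bilinear pairing then gives \<open>\<Phi> f = f b\<close>.\<close>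

lemma reflexive_space_E: "reflexive_space E"
  unfolding reflexive_space_def
proof
  fix \<Phi> assume "\<Phi> \<in> carr (dual_space (dual_space E))"
  then have \<Phi>: "bounded_linear_map (dual_space E) scalar_space \<Phi>"
    by (simp add: dual_space_def[of "dual_space E"])
  have add: "\<Phi> (f + g) = \<Phi> f + \<Phi> g"
    if "f \<in> carr (dual_space E)" "g \<in> carr (dual_space E)" for f g
    using \<Phi> that by (simp add: bounded_linear_map_def linear_map_def)
  have scale: "\<Phi> (\<lambda>x. c * f x) = c * \<Phi> f" if "f \<in> carr (dual_space E)" for c f
    using \<Phi> that by (simp add: bounded_linear_map_def linear_map_def scal_dual scalar_space_def)
  have "\<exists>B. \<forall>f\<in>carr (dual_space E). norm (\<Phi> f) \<le> B * nrm (dual_space E) f"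
    using \<Phi> unfolding bounded_linear_map_def by (simp add: scalar_space_def)
  then obtain B where
    B: "\<And>f. f \<in> carr (dual_space E) \<Longrightarrow> norm (\<Phi> f) \<le> B * op_norm E scalar_space f"
    unfolding nrm_dual by blast
  have "bounded_linear_map ell2 scalar_space (\<lambda>a. \<Phi> (pairing a))"
  proof -
    have "\<Phi> (pairing (a + b)) = \<Phi> (pairing a) + \<Phi> (pairing b)"
      if a: "a \<in> carr ell2" and b: "b \<in> carr ell2" for a b
    proof -
      have "pairing (a + b) = pairing a + pairing b"
        using suminf_add[OF ell2_pairing(1)[OF a] ell2_pairing(1)[OF b]]
        by (auto simp: pairing_def fun_eq_iff distrib_right)
      then show ?thesis using add[OF pairing_in_dual[OF a] pairing_in_dual[OF b]] by simp
    qed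
    moreover have "\<Phi> (pairing (\<lambda>n. c * a n)) = c * \<Phi> (pairing a)" if a: "a \<in> carr ell2" for c a
    proof -
      have "pairing (\<lambda>n. c * a n) = (\<lambda>x. c * pairing a x)"
        using suminf_mult[OF ell2_pairing(1)[OF a]]
        by (auto simp: pairing_def fun_eq_iff mult.assoc)
      then show ?thesis using scale[OF pairing_in_dual[OF a]] by simp
    qed
    moreover have "norm (\<Phi> (pairing a)) \<le> (\<bar>B\<bar> * C) * nrm ell2 a" if a: "a \<in> carr ell2" for a
    proof -
      have f: "pairing a \<in> carr (dual_space E)" by (rule pairing_in_dual[OF a])
      \<comment> \<open>The supremum is over a bounded set containing 0, the value at the origin.
        Its nonnegativity allows \<open>B\<close> to be replaced by its absolute value.\<close>
      have "0 \<le> op_norm E scalar_space (pairing a)"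
        unfolding op_norm_def
      proof (rule cSup_upper)
        show "0 \<in> {nrm scalar_space (pairing a x) |x. x \<in> carr E \<and> nrm E x \<le> 1}"
          using zero_in_ell2 N_eq_0_iff[OF zero_in_ell2]
          by (auto intro!: exI[of _ 0] simp: pairing_def scalar_space_def)
        show "bdd_above {nrm scalar_space (pairing a x) |x. x \<in> carr E \<and> nrm E x \<le> 1}"
        proof (rule bdd_aboveI[of _ "nrm ell2 a * C"])
          fix r assume "r \<in> {nrm scalar_space (pairing a x) |x. x \<in> carr E \<and> nrm E x \<le> 1}"
          then obtain x where x: "x \<in> carr ell2" "N x \<le> 1" and r: "r = norm (pairing a x)"
            by (auto simp: scalar_space_def)
          have "r \<le> nrm ell2 a * nrm ell2 x"
            using ell2_pairing(2)[OF a x(1)] x r by (simp add: pairing_def)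
          also have "nrm ell2 x \<le> C"
            using nrm_le[OF x(1)] mult_left_mono[OF x(2) less_imp_le[OF C_pos]] by linarith
          finally show "r \<le> nrm ell2 a * C"
            using nrm_ell2_nonneg[OF a] by (simp add: mult_left_mono)
        qed
      qed
      then have "norm (\<Phi> (pairing a)) \<le> \<bar>B\<bar> * op_norm E scalar_space (pairing a)"
        using B[OF f] mult_right_mono[OF abs_ge_self] by (meson order_trans)
      also have "\<dots> \<le> \<bar>B\<bar> * (C * nrm ell2 a)"
        by (intro mult_left_mono op_norm_pairing_le a) simp
      finally show ?thesis by (simp add: mult.assoc)
    qed
    ultimately show ?thesis by (rule bounded_linear_map_ell2I)
  qed
  then obtain b where b: "b \<in> carr ell2"
    and \<Phi>_pairing: "\<And>a. a \<in> carr ell2 \<Longrightarrow> \<Phi> (pairing a) = (\<Sum>n. b n * a n)"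
    by (rule ell2_riesz) blast
  have "\<Phi> f = f b" if f: "f \<in> carr (dual_space E)" for f
  proof -
    obtain a where a: "a \<in> carr ell2" and fa: "\<And>x. x \<in> carr ell2 \<Longrightarrow> f x = (\<Sum>n. a n * x n)"
      using f ell2_riesz unfolding carr_dual_E by blast
    have "f = pairing a" using fa f by (auto simp: pairing_def carr_dual_E fun_eq_iff)
    then show ?thesis using \<Phi>_pairing[OF a] fa[OF b] by (simp add: mult.commute)
  qed
  then show "\<exists>x\<in>carr E. \<forall>f\<in>carr (dual_space E). \<Phi> f = f x" using b by auto
qed

text \<open>The coordinate functional at index 0, cut off outside the carrier, is constantly
  \<open>c\<close> along the sequence.\<close>

lemma not_weakly_null:
  assumes "\<And>n. x n \<in> carr ell2" "\<And>n. x n 0 = c" "c \<noteq> 0"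
  shows "\<not> weakly_null E x"
proof
  assume null: "weakly_null E x"
  let ?f = "\<lambda>x::nat \<Rightarrow> 'k. if x \<in> carr ell2 then x 0 else 0"
  have "bounded_linear_map ell2 scalar_space ?f"
    by (rule bounded_linear_map_ell2I[where B = 1]) (auto simp: ell2_add ell2_scale norm_le_nrm_ell2)
  then have "?f \<in> carr (dual_space E)" by (simp add: carr_dual_E)
  from bspec[OF null[unfolded weakly_null_def] this] show False
    using assms by (simp add: LIMSEQ_const_iff)
qed

end

section \<open>Equality of the norm topologies\<close>

interpretation ell2: ell2_renorming "nrm ell2" 1
  by unfold_locales (auto simp: ell2_add ell2_scale)

lemma ell2_E: "ell2.E = ell2"
  by (simp add: ell2.E_def)

context ell2_renorming
begin

text \<open>A ball of radius \<open>r / C\<close> for one norm lies in the ball of radius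
  \<open>r\<close> for the other; this lemma and the next use it in the two directions.\<close>

lemma mtopology_le:
  assumes "openin ell2.mtopology U"
  shows "openin mtopology U"
  unfolding openin_mtopology
proof (intro conjI allI impI)
  show U: "U \<subseteq> carr ell2" using assms ell2.openin_mtopology by blast
  fix x assume x: "x \<in> U"
  then obtain r where "0 < r" and r: "ell2.mball x r \<subseteq> U"
    using assms unfolding ell2.openin_mtopology by blast
  have "mball x (r / C) \<subseteq> ell2.mball x r"
  proof
    fix y assume y: "y \<in> mball x (r / C)"
    then have "N (x - y) < r / C" by (auto simp: nrm_dist_E)
    moreover have "nrm ell2 (x - y) \<le> C * N (x - y)"
      using y by (intro nrm_le ell2_diff) auto
    ultimately have "nrm ell2 (x - y) < r" using C_pos by (simp add: field_simps)
    then show "y \<in> ell2.mball x r" using y by (auto simp: ell2.nrm_dist_E)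
  qed
  then show "\<exists>r>0. mball x r \<subseteq> U" using r \<open>0 < r\<close> C_pos by (intro exI[of _ "r / C"]) auto
qed

lemma mtopology_ge:
  assumes "openin mtopology U"
  shows "openin ell2.mtopology U"
  unfolding ell2.openin_mtopology
proof (intro conjI allI impI)
  show U: "U \<subseteq> carr ell2" using assms openin_mtopology by blast
  fix x assume x: "x \<in> U"
  then obtain r where "0 < r" and r: "mball x r \<subseteq> U"
    using assms unfolding openin_mtopology by blast
  have "ell2.mball x (r / C) \<subseteq> mball x r"
  proof
    fix y assume y: "y \<in> ell2.mball x (r / C)"
    then have "nrm ell2 (x - y) < r / C" by (auto simp: ell2.nrm_dist_E)
    moreover have "N (x - y) \<le> C * nrm ell2 (x - y)"
      using y by (intro le_nrm ell2_diff) auto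
    ultimately have "N (x - y) < r" using C_pos by (simp add: field_simps)
    then show "y \<in> mball x r" using y by (auto simp: nrm_dist_E)
  qed
  then show "\<exists>r>0. ell2.mball x r \<subseteq> U" using r \<open>0 < r\<close> C_pos by (intro exI[of _ "r / C"]) auto
qed

text \<open>Both topologies coincide on the common carrier, so the identity is the
  isomorphism.\<close>

lemma isomorphic_ell2: "isomorphic_spaces E ell2"
proof -
  have "mtopology = ell2.mtopology"
    using mtopology_le mtopology_ge by (auto simp: topology_eq)
  then have "nrm_topology E = nrm_topology ell2"
    by (simp add: nrm_topology_def ell2_E)
  then show ?thesis
    unfolding isomorphic_spaces_def
    by (intro exI[of _ id]) (auto simp: linear_map_def)
qed

end

section \<open>Failure of the weak maximizing property\<close>

text \<open>The constant \<open>B\<close> bounds the operator norm from above and the values along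
  \<open>y\<close> bound it from below, so it equals \<open>B\<close>; the strict inequality on the
  sphere then excludes attainment.\<close>

lemma not_WMP:
  assumes lin: "linear_map E F T"
    and zero: "z \<in> carr E" "nrm E z \<le> 1"
    and B: "0 \<le> B" "\<And>x. x \<in> carr E \<Longrightarrow> nrm F (T x) \<le> B * nrm E x"
    and less: "\<And>x. x \<in> carr E \<Longrightarrow> nrm E x = 1 \<Longrightarrow> nrm F (T x) < B"
    and y: "\<And>n. y n \<in> carr E" "\<And>n. nrm E (y n) = 1" "(\<lambda>n. nrm F (T (y n))) \<longlonglongrightarrow> B"
    and weak: "\<not> weakly_null E y"
  shows "\<not> WMP E F"
proof -
  have "nrm F (T x) \<le> B" if "x \<in> carr E" "nrm E x \<le> 1" for x
    using B(2)[OF that(1)] mult_left_mono[OF that(2) B(1)] by linarith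
  then have "bdd_above {nrm F (T x) |x. x \<in> carr E \<and> nrm E x \<le> 1}"
    by (intro bdd_aboveI[of _ B]) auto
  then have "nrm F (T (y n)) \<le> op_norm E F T" for n
    unfolding op_norm_def using y by (intro cSup_upper) (auto simp: exI[of _ "y n"])
  then have "B \<le> op_norm E F T" using LIMSEQ_le_const2[OF y(3)] by blast
  then have op: "op_norm E F T = B" using op_norm_le[OF zero B] by simp
  have "bounded_linear_map E F T" using lin B(2) unfolding bounded_linear_map_def by blast
  moreover have "maximizing_sequence E F T y"
    using y by (simp add: maximizing_sequence_def unit_sphere_def op)
  moreover have "\<not> attains_norm E F T"
    using less by (force simp: attains_norm_def unit_sphere_def op)
  ultimately show ?thesis using weak unfolding WMP_def by blast
qed

section \<open>Splitting off one coordinate; the sum and max norms\<close>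

lemma ell2_tail:
  fixes x :: "nat \<Rightarrow> 'k::real_normed_field"
  assumes "x \<in> carr ell2"
  shows "x(0 := 0) \<in> carr ell2" "(nrm ell2 x)\<^sup>2 = (norm (x 0))\<^sup>2 + (nrm ell2 (x(0 := 0)))\<^sup>2"
proof -
  have s: "summable (\<lambda>n. (norm (x n))\<^sup>2)" using assms by (simp add: carr_ell2_iff)
  have eq: "(norm ((x(0 := 0)) n))\<^sup>2 = (norm (x n))\<^sup>2 - (if n = 0 then (norm (x 0))\<^sup>2 else 0)" for n
    by simp
  have *: "(\<lambda>n. (norm ((x(0 := 0)) n))\<^sup>2) sums ((nrm ell2 x)\<^sup>2 - (norm (x 0))\<^sup>2)"
    unfolding eq nrm_ell2_power2[OF assms] by (intro sums_diff summable_sums[OF s] sums_single)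
  then show tail: "x(0 := 0) \<in> carr ell2" by (auto simp: carr_ell2_iff sums_iff simp del: fun_upd_apply)
  then show "(nrm ell2 x)\<^sup>2 = (norm (x 0))\<^sup>2 + (nrm ell2 (x(0 := 0)))\<^sup>2"
    using * by (simp add: nrm_ell2_power2 sums_iff del: fun_upd_apply)
qed

text \<open>The 1-sum of the scalars and \<open>ell2\<close>: coordinate 0 is the scalar part, and
  zeroing it leaves the \<open>ell2\<close> part without any shift of indices.
  \<open>max_norm\<close> is the corresponding max-sum.\<close>

definition sum_norm :: "(nat \<Rightarrow> 'k::real_normed_field) \<Rightarrow> real" where
  "sum_norm x = norm (x 0) + nrm ell2 (x(0 := 0))"

definition max_norm :: "(nat \<Rightarrow> 'k::real_normed_field) \<Rightarrow> real" where
  "max_norm x = max (norm (x 0)) (nrm ell2 (x(0 := 0)))"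

lemma nrm_ell2_tail_le:
  assumes "x \<in> carr ell2"
  shows "nrm ell2 (x(0 := 0)) \<le> nrm ell2 x"
  using ell2_tail(2)[OF assms] nrm_ell2_nonneg[OF assms]
  by - (rule power2_le_imp_le, simp_all)

text \<open>For nonnegative \<open>a\<close> and \<open>b\<close>, the square of
  \<open>a + b\<close> exceeds the sum of squares by \<open>2 a b\<close>.\<close>

lemma nrm_ell2_le_sum_norm:
  assumes "x \<in> carr ell2"
  shows "nrm ell2 x \<le> sum_norm x"
  using ell2_tail(2)[OF assms] nrm_ell2_nonneg[OF ell2_tail(1)[OF assms]]
  by - (rule power2_le_imp_le, simp_all add: sum_norm_def power2_sum)

lemma nrm_ell2_tail_add:
  assumes "x \<in> carr ell2" "y \<in> carr ell2"
  shows "nrm ell2 ((x + y)(0 := 0)) \<le> nrm ell2 (x(0 := 0)) + nrm ell2 (y(0 := 0))"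
proof -
  have "(x + y)(0 := 0) = x(0 := 0) + y(0 := 0)" by (auto simp: fun_eq_iff)
  then show ?thesis using ell2_add(2)[OF ell2_tail(1)[OF assms(1)] ell2_tail(1)[OF assms(2)]] by simp
qed

lemma nrm_ell2_tail_scale:
  assumes "x \<in> carr ell2"
  shows "nrm ell2 ((\<lambda>n. c * x n)(0 := 0)) = norm c * nrm ell2 (x(0 := 0))"
proof -
  have "(\<lambda>n. c * x n)(0 := 0) = (\<lambda>n. c * (x(0 := 0)) n)" by (auto simp: fun_eq_iff)
  then show ?thesis using ell2_scale(2)[OF ell2_tail(1)[OF assms]] by metis
qed

interpretation sum_norm: ell2_renorming sum_norm 2
proof
  fix x y :: "nat \<Rightarrow> 'k::{real_normed_field,banach}" and c :: 'k assume x: "x \<in> carr ell2"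
  show "nrm ell2 x \<le> 2 * sum_norm x"
    using nrm_ell2_le_sum_norm[OF x] nrm_ell2_nonneg[OF x] by linarith
  show "sum_norm x \<le> 2 * nrm ell2 x"
    using norm_le_nrm_ell2[OF x, of 0] nrm_ell2_tail_le[OF x] by (simp add: sum_norm_def)
  show "sum_norm (\<lambda>n. c * x n) = norm c * sum_norm x"
    by (simp add: sum_norm_def nrm_ell2_tail_scale[OF x] norm_mult distrib_left)
  assume y: "y \<in> carr ell2"
  show "sum_norm (x + y) \<le> sum_norm x + sum_norm y"
    using nrm_ell2_tail_add[OF x y] norm_triangle_ineq[of "x 0" "y 0"] by (simp add: sum_norm_def)
qed simp

text \<open>The \<open>ell2\<close> norm is at most the sum of the two parts, hence at most twice
  the larger; each part is at most the \<open>ell2\<close> norm.\<close>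

interpretation max_norm: ell2_renorming max_norm 2
proof
  fix x y :: "nat \<Rightarrow> 'k::{real_normed_field,banach}" and c :: 'k assume x: "x \<in> carr ell2"
  show "nrm ell2 x \<le> 2 * max_norm x"
    using nrm_ell2_le_sum_norm[OF x] by (simp add: sum_norm_def max_norm_def)
  show "max_norm x \<le> 2 * nrm ell2 x"
    using norm_le_nrm_ell2[OF x, of 0] nrm_ell2_tail_le[OF x] nrm_ell2_nonneg[OF x]
    by (simp add: max_norm_def)
  show "max_norm (\<lambda>n. c * x n) = norm c * max_norm x"
    by (simp add: max_norm_def nrm_ell2_tail_scale[OF x] norm_mult max_mult_distrib_left)
  assume y: "y \<in> carr ell2"
  show "max_norm (x + y) \<le> max_norm x + max_norm y"
    using nrm_ell2_tail_add[OF x y] norm_triangle_ineq[of "x 0" "y 0"]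
    by (simp add: max_norm_def) linarith
qed simp

section \<open>The diagonal operator\<close>

definition D :: "(nat \<Rightarrow> 'k::real_normed_field) \<Rightarrow> nat \<Rightarrow> 'k" where
  "D x = (\<lambda>n. of_real (real n / real (Suc n)) * x n)"

text \<open>The weight at index 0 vanishes, so \<open>D\<close> kills the scalar part and acts on
  the tail alone.\<close>

lemma D_zero [simp]: "D x 0 = 0"
  by (simp add: D_def)

lemma D_tail: "D (x(0 := 0)) = D x"
  by (auto simp: D_def fun_eq_iff)

lemma norm_D_le: "norm (D x n) \<le> norm (x n)"
  unfolding D_def norm_mult norm_of_real by (intro mult_left_le_one_le) auto

lemma D_in_ell2:
  assumes "x \<in> carr ell2"
  shows "D x \<in> carr ell2"
proof -
  have "(norm (D x n))\<^sup>2 \<le> (norm (x n))\<^sup>2" for n by (simp add: norm_D_le power_mono)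
  then show ?thesis
    using assms summable_comparison_test'[of "\<lambda>n. (norm (x n))\<^sup>2" 0 "\<lambda>n. (norm (D x n))\<^sup>2"]
    by (simp add: carr_ell2_iff)
qed

text \<open>All weights are below 1, so a single nonzero coordinate already makes the sum of squares
  strictly smaller.\<close>

lemma nrm_D_less:
  assumes x: "x \<in> carr ell2" and "x \<noteq> 0"
  shows "nrm ell2 (D x) < nrm ell2 x"
proof -
  obtain i where "x i \<noteq> 0" using \<open>x \<noteq> 0\<close> by (auto simp: fun_eq_iff)
  then have "norm (D x i) < norm (x i)"
    unfolding D_def norm_mult norm_of_real by (simp add: field_simps)
  then have i: "0 < (norm (x i))\<^sup>2 - (norm (D x i))\<^sup>2" by (simp add: power_strict_mono)
  have s: "summable (\<lambda>n. (norm (x n))\<^sup>2)" "summable (\<lambda>n. (norm (D x n))\<^sup>2)"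
    using x D_in_ell2[OF x] by (simp_all add: carr_ell2_iff)
  have "0 < (\<Sum>n. (norm (x n))\<^sup>2 - (norm (D x n))\<^sup>2)"
    by (rule suminf_pos2[OF summable_diff[OF s] _ i]) (simp add: norm_D_le power_mono)
  then show ?thesis by (simp add: suminf_diff[OF s, symmetric] nrm_ell2)
qed

lemma nrm_D_le: "x \<in> carr ell2 \<Longrightarrow> nrm ell2 (D x) \<le> nrm ell2 x"
  using nrm_D_less[of x] by (cases "x = 0") (auto simp: D_def nrm_ell2)

text \<open>A vector of max norm 1 may have zero tail, and then its image is 0; otherwise
  \<open>D\<close> strictly shrinks a tail of norm at most 1.\<close>

lemma nrm_D_tail_less:
  assumes "x \<in> carr ell2" "max_norm x = 1"
  shows "nrm ell2 (D x) < 1"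
proof (cases "x(0 := 0) = 0")
  case True
  then have "D x = 0" using D_tail[of x] by (simp add: D_def fun_eq_iff)
  then show ?thesis by (simp add: nrm_ell2_zero)
next
  case False
  then show ?thesis
    using nrm_D_less[OF ell2_tail(1)[OF assms(1)]] assms(2) by (simp add: D_tail max_norm_def)
qed

section \<open>Test sequences and the failing pairs\<close>

lemma tail_pair: "((\<lambda>_. 0)(0 := c, Suc n := c))(0 := 0) = (\<lambda>_. 0)(Suc n := c)"
  by (auto simp: fun_eq_iff)

lemma D_pair:
  "D ((\<lambda>_. 0)(0 := c, Suc n := c)) = (\<lambda>_. 0)(Suc n := of_real (real (Suc n) / real (Suc (Suc n))) * c)"
  by (auto simp: D_def fun_eq_iff)

lemma pair_in_ell2: "(\<lambda>_. 0)(0 := c, Suc n := c) \<in> carr ell2"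
  by (rule ell2_finite_support[of "Suc (Suc n)"]) auto

lemma nrm_D_pair:
  "nrm ell2 (D ((\<lambda>_. 0)(0 := c, Suc n := c))) = real (Suc n) / real (Suc (Suc n)) * norm c"
  unfolding D_pair ell2_single norm_mult norm_of_real by simp

lemma weights_tendsto: "(\<lambda>n. real (Suc n) / real (Suc (Suc n))) \<longlonglongrightarrow> 1"
  using LIMSEQ_Suc[OF LIMSEQ_n_over_Suc_n] by simp

lemma D_add: "D (x + y) = D x + D y"
  by (simp add: D_def fun_eq_iff distrib_left)

lemma D_scale: "D (\<lambda>n. c * x n) = (\<lambda>n. c * D x n)"
  by (simp add: D_def fun_eq_iff)

text \<open>The range of \<open>D\<close> consists of sequences vanishing at 0, and only there is
  the norm of \<open>F\<close> prescribed. This covers both \<open>ell2\<close> and the max-sum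
  itself as target.\<close>

lemma not_WMP_max_norm:
  fixes F :: "('k::{real_normed_field,banach}, nat \<Rightarrow> 'k) normed_space"
  assumes F: "carr F = carr ell2" "scal F = scal ell2"
    "\<And>x. x \<in> carr ell2 \<Longrightarrow> x 0 = 0 \<Longrightarrow> nrm F x = nrm ell2 x"
  shows "\<not> WMP max_norm.E F"
proof (rule not_WMP[where T = D and B = 1 and z = 0])
  \<comment> \<open>The entry at 0 leaves the max norm at 1 and prevents weak convergence to 0; the
    index \<open>Suc n\<close> keeps the moving entry away from it.\<close>
  define y :: "nat \<Rightarrow> nat \<Rightarrow> 'k" where "y n = (\<lambda>_. 0)(0 := 1, Suc n := 1)" for n
  have nrmF: "nrm F (D x) = nrm ell2 (D x)" if "x \<in> carr ell2" for x
    using F(3)[OF D_in_ell2[OF that]] by simp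
  show "linear_map max_norm.E F D"
    by (auto simp: linear_map_def F scal_ell2 D_in_ell2 D_add D_scale)
  show "(0 :: nat \<Rightarrow> 'k) \<in> carr max_norm.E" "nrm max_norm.E (0 :: nat \<Rightarrow> 'k) \<le> 1"
    using zero_in_ell2 max_norm.N_eq_0_iff[OF zero_in_ell2[where 'k = 'k]] by simp_all
  show "nrm F (D x) \<le> 1 * nrm max_norm.E x" if "x \<in> carr max_norm.E" for x
    using that nrm_D_le[OF ell2_tail(1), of x] by (simp add: D_tail max_norm_def nrmF)
  show "nrm F (D x) < 1" if "x \<in> carr max_norm.E" "nrm max_norm.E x = 1" for x
    using that nrm_D_tail_less by (simp add: nrmF)
  have y_in: "y n \<in> carr ell2" for n by (simp add: y_def pair_in_ell2 del: fun_upd_apply)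
  then show "y n \<in> carr max_norm.E" for n by simp
  show "nrm max_norm.E (y n) = 1" for n
    unfolding y_def max_norm.E_simps max_norm_def tail_pair ell2_single by simp
  have "nrm F (D (y n)) = real (Suc n) / real (Suc (Suc n))" for n
    unfolding nrmF[OF y_in] unfolding y_def nrm_D_pair by simp
  then show "(\<lambda>n. nrm F (D (y n))) \<longlonglongrightarrow> 1" using weights_tendsto by simp
  show "\<not> weakly_null max_norm.E y"
    by (rule max_norm.not_weakly_null[where x = y and c = 1]) (simp_all add: y_in, simp_all add: y_def)
qed simp

text \<open>The operator keeps coordinate 0, which \<open>D\<close> alone would kill, and applies
  \<open>D\<close> to the tail. Equality in the AM-GM bound requires a nonzero tail, and that is
  exactly where \<open>D\<close> loses norm.\<close>

lemma not_WMP_sum_norm: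
  "\<not> WMP ell2 (sum_norm.E :: ('k::{real_normed_field,banach}, nat \<Rightarrow> 'k) normed_space)"
proof (rule not_WMP[where T = "\<lambda>x. (D x)(0 := x 0)" and B = "sqrt 2" and z = 0])
  let ?T = "\<lambda>x::nat \<Rightarrow> 'k. (D x)(0 := x 0)"
  \<comment> \<open>Equal entries give equality in AM-GM before \<open>D\<close> is applied, and
    this value of \<open>c\<close> makes \<open>y n\<close> a unit vector.\<close>
  define c :: 'k where "c = of_real (1 / sqrt 2)"
  define y :: "nat \<Rightarrow> nat \<Rightarrow> 'k" where "y n = (\<lambda>_. 0)(0 := c, Suc n := c)" for n
  have norm_c: "norm c = 1 / sqrt 2" unfolding c_def norm_of_real by simp
  have T_eq: "?T x = D x + (\<lambda>_. 0)(0 := x 0)" for x by (auto simp: fun_eq_iff)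
  have T_in: "?T x \<in> carr ell2" if "x \<in> carr ell2" for x
    unfolding T_eq by (intro ell2_add D_in_ell2 ell2_single that)
  show "linear_map ell2 sum_norm.E ?T"
    using T_in by (auto simp: linear_map_def scal_ell2 D_add D_scale fun_eq_iff)
  show "(0 :: nat \<Rightarrow> 'k) \<in> carr ell2" "nrm ell2 (0 :: nat \<Rightarrow> 'k) \<le> 1"
    using zero_in_ell2 by (simp_all add: nrm_ell2_zero)
  have nrm_T: "sum_norm (?T x) = norm (x 0) + nrm ell2 (D x)" for x
  proof -
    have "(D x)(0 := 0) = D x" by (auto simp: fun_eq_iff)
    then show ?thesis by (simp add: sum_norm_def)
  qed
  have am_gm: "norm (x 0) + nrm ell2 (x(0 := 0)) \<le> sqrt 2 * nrm ell2 x"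
    if x: "x \<in> carr ell2" for x :: "nat \<Rightarrow> 'k"
  proof (rule power2_le_imp_le)
    show "(norm (x 0) + nrm ell2 (x(0 := 0)))\<^sup>2 \<le> (sqrt 2 * nrm ell2 x)\<^sup>2"
      using ell2_tail(2)[OF x] sum_squares_bound[of "norm (x 0)" "nrm ell2 (x(0 := 0))"]
      by (simp add: power_mult_distrib power2_sum)
  qed (use nrm_ell2_nonneg[OF x] in simp)
  show "nrm sum_norm.E (?T x) \<le> sqrt 2 * nrm ell2 x" if "x \<in> carr ell2" for x
    using am_gm[OF that] nrm_D_le[OF ell2_tail(1)[OF that]] by (simp add: nrm_T D_tail)
  show "nrm sum_norm.E (?T x) < sqrt 2" if x: "x \<in> carr ell2" and 1: "nrm ell2 x = 1" for x
  \<comment> \<open>On a zero tail \<open>D\<close> gives no strict loss, but the image then has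
    norm at most 1, below \<open>sqrt 2\<close>.\<close>
  proof (cases "x(0 := 0) = 0")
    case True
    then have "D x = 0" using D_tail[of x] by (simp add: D_def fun_eq_iff)
    then have "nrm sum_norm.E (?T x) \<le> 1"
      using norm_le_nrm_ell2[OF x, of 0] 1
      unfolding sum_norm.E_simps nrm_T by (simp add: nrm_ell2_zero)
    moreover have "1 < sqrt (2::real)" by simp
    ultimately show ?thesis by linarith
  next
    case False
    then show ?thesis
      using nrm_D_less[OF ell2_tail(1)[OF x]] am_gm[OF x] 1 by (simp add: nrm_T D_tail)
  qed
  show y_in: "y n \<in> carr ell2" for n by (simp add: y_def pair_in_ell2 del: fun_upd_apply)
  show "nrm ell2 (y n) = 1" for n
  proof -
    have "(nrm ell2 (y n))\<^sup>2 = (norm c)\<^sup>2 + (norm c)\<^sup>2"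
      using ell2_tail(2)[OF y_in[of n]] unfolding y_def tail_pair ell2_single by simp
    then have "(nrm ell2 (y n))\<^sup>2 = 1\<^sup>2" by (simp add: norm_c power_divide)
    then show ?thesis using nrm_ell2_nonneg[OF y_in] by (simp only: power2_eq_iff_nonneg zero_le_one)
  qed
  have "nrm sum_norm.E (?T (y n)) = 1 / sqrt 2 + real (Suc n) / real (Suc (Suc n)) * (1 / sqrt 2)" for n
    unfolding sum_norm.E_simps nrm_T unfolding y_def nrm_D_pair norm_c by (simp add: norm_c)
  moreover have "(\<lambda>n. 1 / sqrt 2 + real (Suc n) / real (Suc (Suc n)) * (1 / sqrt 2))
      \<longlonglongrightarrow> 1 / sqrt 2 + 1 * (1 / sqrt 2)"
    by (intro tendsto_intros weights_tendsto)
  moreover have "1 / sqrt 2 + 1 * (1 / sqrt 2) = sqrt 2" by (simp add: field_simps)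
  ultimately show "(\<lambda>n. nrm sum_norm.E (?T (y n))) \<longlonglongrightarrow> sqrt 2" by simp
  have "c \<noteq> 0" using norm_c by auto
  then show "\<not> weakly_null ell2 y"
    using ell2.not_weakly_null[of y c] y_in unfolding ell2_E by (simp add: y_def)
qed simp

text \<open>Stated for every complete normed field over the reals, so that the real and complex
  cases are instances of one proof.\<close>

lemma WMP_counterexamples:
  "\<exists>E1 E2 E3 :: ('k::{real_normed_field,banach}, nat \<Rightarrow> 'k) normed_space.
      (\<forall>E\<in>{E1, E2, E3}. banach_space E \<and> reflexive_space E \<and> isomorphic_spaces E ell2) \<and>
      \<not> WMP ell2 E1 \<and> \<not> WMP E2 ell2 \<and> \<not> WMP E3 E3"
proof (rule exI[of _ sum_norm.E], rule exI[of _ max_norm.E], rule exI[of _ max_norm.E], intro conjI)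
  \<comment> \<open>This agreement of norms lets the same operator \<open>D\<close> serve as a map
    of the max-sum into itself.\<close>
  have "max_norm x = nrm ell2 x" if "x \<in> carr ell2" "x 0 = 0" for x :: "nat \<Rightarrow> 'k"
  proof -
    have "x(0 := 0) = x" using that(2) by (auto simp: fun_eq_iff)
    then show ?thesis using that nrm_ell2_nonneg[OF that(1)] by (simp add: max_norm_def)
  qed
  then show "\<not> WMP max_norm.E (max_norm.E :: ('k, nat \<Rightarrow> 'k) normed_space)"
    by (intro not_WMP_max_norm) simp_all
  show "\<not> WMP max_norm.E (ell2 :: ('k, nat \<Rightarrow> 'k) normed_space)"
    by (rule not_WMP_max_norm) simp_all
qed (use sum_norm.banach_space_E sum_norm.reflexive_space_E sum_norm.isomorphic_ell2
      max_norm.banach_space_E max_norm.reflexive_space_E max_norm.isomorphic_ell2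
      not_WMP_sum_norm in auto)

theorem corollary2p3:
  "(\<exists>E1 E2 E3 :: (real, nat \<Rightarrow> real) normed_space.
      (\<forall>E\<in>{E1, E2, E3}. banach_space E \<and> reflexive_space E \<and> isomorphic_spaces E ell2) \<and>
      \<not> WMP ell2 E1 \<and> \<not> WMP E2 ell2 \<and> \<not> WMP E3 E3) \<and>
   (\<exists>E1 E2 E3 :: (complex, nat \<Rightarrow> complex) normed_space.
      (\<forall>E\<in>{E1, E2, E3}. banach_space E \<and> reflexive_space E \<and> isomorphic_spaces E ell2) \<and>
      \<not> WMP ell2 E1 \<and> \<not> WMP E2 ell2 \<and> \<not> WMP E3 E3)"
  by (intro conjI WMP_counterexamples)

end
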